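(* Let $G=(V,E,l,u,S,T,d,c)$ be a planar interdiction network with $-d(S)=d(T)$, and let $\widehat{G}=(V,\widehat{E}=E\cup\mathcal{T},\widehat{l},\widehat{u},\widehat{c})$ be the auxiliary network constructed from a tree $\mathcal{T}'$ as described in the context. Then for every interdiction set $R\subset V\cup E$ of $G$: there is a saturating flow in $G\setminus R$ if and only if there is a circulation in $\widehat{G}(R)$.
   Context: $G=(V,E,l,u,S,T,d,c)$: directed planar graph $(V,E)$ with lower and upper arc capacities $l(e)\le u(e)$ in $\{0,1,2,\dots\}$, disjoint source set $S$ and sink set $T$, integral supply/demand $d$ with $d(s)<0$ for $s\in S$, $d(t)>0$ for $t\in T$, $d(v)=0$ otherwise, and $d(S)=\sum_{s\in S}d(s)$, $d(T)=\sum_{t\in T}d(t)$; interdiction costs $c(p)\in\{1,2,\dots\}\cup\{\infty\}$ for $p\in V\cup E$, with $c=\infty$ on $S\cup T$. An interdiction set is $R\subset V\cup E$ with $c(R)\le B$ for a given budget $B$. $G\setminus R$ is obtained by deleting the arcs of $R$ and the vertices of $R$ with all incident arcs. A saturating flow is $f$ with $l\le f\le u$, net outflow $-d(s)$ at each source, net inflow $d(t)$ at each sink and conservation elsewhere. A circulation in a network with lower/upper capacities is $f$ with $l\le f\le u$ and conservation at every vertex. Construction of $\widehat{G}$: let $\mathcal{T}'$ be an undirected tree on vertices of $V$ spanning $S\cup T$ that can be added to $G$ without destroying planarity. For an edge $\{v,w\}$ of $\mathcal{T}'$ let $V_{\mathcal{T}'}(v,w)$ be the set of vertices connected to $v$ in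 $\mathcal{T}'\setminus\{v,w\}$. Orient $\{v,w\}$ from $v$ to $w$ if $d(V_{\mathcal{T}'}(v,w))\ge 0$ and from $w$ to $v$ otherwise; the resulting arc set is $\mathcal{T}$. Set $\widehat{E}=E\cup\mathcal{T}$, $\widehat{l},\widehat{u}$ extend $l,u$ with $\widehat{l}(v,w)=\widehat{u}(v,w)=d(V_{\mathcal{T}'}(v,w))$ for $(v,w)\in\mathcal{T}$, and $\widehat{c}$ extends $c$ with $\widehat{c}=\infty$ on $\mathcal{T}$. For $R\subset V\cup E$, $\widehat{G}(R)$ is obtained from $\widehat{G}$ by removing all arcs in $R$ and all arcs of $E$ incident to a vertex in $R$ (arcs of $\mathcal{T}$ are kept). *)

theory Defs
  imports
    "HOL-Analysis.Analysis"
    "HOL-Library.Extended_Nat"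
    "Graph_Theory.Digraph"
begin

text \<open>
  Planarity of a multigraph with vertex set \<open>V\<close>, edge set \<open>E\<close> and end vertices \<open>ends e\<close> (a singleton
  for a loop). As a \<^const>\<open>simple_path\<close> may be closed, loops are drawn as Jordan curves.
\<close>

definition planar_drawing ::
  "'v set \<Rightarrow> 'e set \<Rightarrow> ('e \<Rightarrow> 'v set) \<Rightarrow> ('v \<Rightarrow> complex) \<Rightarrow> ('e \<Rightarrow> real \<Rightarrow> complex) \<Rightarrow> bool" where
  "planar_drawing V E ends pos \<gamma> \<longleftrightarrow>
     inj_on pos V \<and>
     (\<forall>e\<in>E. simple_path (\<gamma> e) \<and>
            {pathstart (\<gamma> e), pathfinish (\<gamma> e)} = pos ` ends e \<and>
            path_image (\<gamma> e) \<inter> pos ` V = pos ` ends e) \<and>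
     (\<forall>e\<in>E. \<forall>e'\<in>E. e \<noteq> e' \<longrightarrow> path_image (\<gamma> e) \<inter> path_image (\<gamma> e') \<subseteq> pos ` V)"

definition planar :: "'v set \<Rightarrow> 'e set \<Rightarrow> ('e \<Rightarrow> 'v set) \<Rightarrow> bool" where
  "planar V E ends \<longleftrightarrow> (\<exists>pos \<gamma>. planar_drawing V E ends pos \<gamma>)"

definition arc_ends :: "('v, 'e) pre_digraph \<Rightarrow> 'e \<Rightarrow> 'v set" where
  "arc_ends H e = {tail H e, head H e}"


text \<open>
  Elements of \<open>V \<union> E\<close> are represented by \<^typ>\<open>'v + 'e\<close>.
\<close>

record ('v, 'e) network =
  dgraph :: "('v, 'e) pre_digraph"
  lcap :: "'e \<Rightarrow> int"
  ucap :: "'e \<Rightarrow> int"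
  icost :: "'v + 'e \<Rightarrow> enat"

record ('v, 'e) interdiction_network = "('v, 'e) network" +
  sources :: "'v set"
  sinks :: "'v set"
  demand :: "'v \<Rightarrow> int"

definition net_outflow :: "('v, 'e) pre_digraph \<Rightarrow> ('e \<Rightarrow> real) \<Rightarrow> 'v \<Rightarrow> real" where
  "net_outflow H f v = (\<Sum>e\<in>out_arcs H v. f e) - (\<Sum>e\<in>in_arcs H v. f e)"

definition net_inflow :: "('v, 'e) pre_digraph \<Rightarrow> ('e \<Rightarrow> real) \<Rightarrow> 'v \<Rightarrow> real" where
  "net_inflow H f v = (\<Sum>e\<in>in_arcs H v. f e) - (\<Sum>e\<in>out_arcs H v. f e)"

definition within_capacities :: "('v, 'e, 'z) network_scheme \<Rightarrow> ('e \<Rightarrow> real) \<Rightarrow> bool" where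
  "within_capacities N f \<longleftrightarrow>
     (\<forall>e\<in>arcs (dgraph N). of_int (lcap N e) \<le> f e \<and> f e \<le> of_int (ucap N e))"

definition circulation :: "('v, 'e, 'z) network_scheme \<Rightarrow> ('e \<Rightarrow> real) \<Rightarrow> bool" where
  "circulation N f \<longleftrightarrow>
     within_capacities N f \<and> (\<forall>v\<in>verts (dgraph N). net_outflow (dgraph N) f v = 0)"

definition saturating_flow :: "('v, 'e, 'z) interdiction_network_scheme \<Rightarrow> ('e \<Rightarrow> real) \<Rightarrow> bool" where
  "saturating_flow N f \<longleftrightarrow>
     within_capacities N f \<and>
     (\<forall>s\<in>sources N. net_outflow (dgraph N) f s = - of_int (demand N s)) \<and>
     (\<forall>t\<in>sinks N. net_inflow (dgraph N) f t = of_int (demand N t)) \<and>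
     (\<forall>v\<in>verts (dgraph N) - (sources N \<union> sinks N). net_outflow (dgraph N) f v = 0)"

locale planar_interdiction_network =
  fixes N :: "('v, 'e) interdiction_network"
  assumes fin_digraph: "fin_digraph (dgraph N)"
    and planar: "planar (verts (dgraph N)) (arcs (dgraph N)) (arc_ends (dgraph N))"
    and lcap_nonneg: "e \<in> arcs (dgraph N) \<Longrightarrow> 0 \<le> lcap N e"
    and lcap_le_ucap: "e \<in> arcs (dgraph N) \<Longrightarrow> lcap N e \<le> ucap N e"
    and sources_verts: "sources N \<subseteq> verts (dgraph N)"
    and sinks_verts: "sinks N \<subseteq> verts (dgraph N)"
    and sources_sinks_disjoint: "sources N \<inter> sinks N = {}"
    and demand_source: "v \<in> sources N \<Longrightarrow> demand N v < 0"
    and demand_sink: "v \<in> sinks N \<Longrightarrow> demand N v > 0"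
    and demand_other: "v \<in> verts (dgraph N) - (sources N \<union> sinks N) \<Longrightarrow> demand N v = 0"
    and icost_pos: "p \<in> Inl ` verts (dgraph N) \<union> Inr ` arcs (dgraph N) \<Longrightarrow> 1 \<le> icost N p"
    and icost_terminal: "v \<in> sources N \<union> sinks N \<Longrightarrow> icost N (Inl v) = \<infinity>"

definition interdiction_set ::
  "('v, 'e, 'z) network_scheme \<Rightarrow> nat \<Rightarrow> ('v + 'e) set \<Rightarrow> bool" where
  "interdiction_set N B R \<longleftrightarrow>
     R \<subseteq> Inl ` verts (dgraph N) \<union> Inr ` arcs (dgraph N) \<and> (\<Sum>p\<in>R. icost N p) \<le> enat B"

definition surviving_arcs :: "('v, 'e) pre_digraph \<Rightarrow> ('v + 'e) set \<Rightarrow> 'e set" where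
  "surviving_arcs H R =
     {e \<in> arcs H. Inr e \<notin> R \<and> Inl (tail H e) \<notin> R \<and> Inl (head H e) \<notin> R}"

definition interdict ::
  "('v, 'e) interdiction_network \<Rightarrow> ('v + 'e) set \<Rightarrow> ('v, 'e) interdiction_network" where
  "interdict N R = N\<lparr>dgraph := (dgraph N)
     \<lparr>verts := {v \<in> verts (dgraph N). Inl v \<notin> R}, arcs := surviving_arcs (dgraph N) R\<rparr>\<rparr>"


text \<open>
  The undirected tree has vertex set \<open>W\<close> and a set \<open>F\<close> of two-element edges.
\<close>

definition adj :: "'v set set \<Rightarrow> 'v rel" where
  "adj F = {(v, w). {v, w} \<in> F}"

definition ucycle :: "'v set set \<Rightarrow> 'v list \<Rightarrow> bool" where
  "ucycle F vs \<longleftrightarrow> length vs \<ge> 3 \<and> distinct vs \<and>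
     (\<forall>i<length vs. {vs ! i, vs ! (Suc i mod length vs)} \<in> F)"

definition utree :: "'v set \<Rightarrow> 'v set set \<Rightarrow> bool" where
  "utree W F \<longleftrightarrow> W \<noteq> {} \<and>
     F \<subseteq> {{v, w} | v w. v \<in> W \<and> w \<in> W \<and> v \<noteq> w} \<and>
     (\<forall>v\<in>W. \<forall>w\<in>W. (v, w) \<in> (adj F)\<^sup>*) \<and>
     (\<nexists>vs. ucycle F vs)"

text \<open>
  The tree edges are added as new edges, possibly parallel to arcs of the network; hence the sum
  types here and in \<open>aux_network\<close> below.
\<close>

definition terminal_tree :: "('v, 'e) interdiction_network \<Rightarrow> 'v set \<Rightarrow> 'v set set \<Rightarrow> bool" where
  "terminal_tree N W F \<longleftrightarrow> utree W F \<and>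
     W \<subseteq> verts (dgraph N) \<and> sources N \<union> sinks N \<subseteq> W \<and>
     planar (verts (dgraph N)) (Inl ` arcs (dgraph N) \<union> Inr ` F)
       (case_sum (arc_ends (dgraph N)) (\<lambda>e. e))"

definition tree_side :: "'v set set \<Rightarrow> 'v \<Rightarrow> 'v \<Rightarrow> 'v set" where
  "tree_side F v w = {x. (v, x) \<in> (adj (F - {{v, w}}))\<^sup>*}"

definition side_demand :: "('v \<Rightarrow> int) \<Rightarrow> 'v set set \<Rightarrow> 'v \<times> 'v \<Rightarrow> int" where
  "side_demand d F = (\<lambda>(v, w). \<Sum>x\<in>tree_side F v w. d x)"

text \<open>
  The rule orienting an edge \<open>{v, w}\<close> refers to an ordered naming of its two ends; \<open>nm\<close> is an
  arbitrary such choice. It only matters for edges whose two sides both have total demand 0.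
\<close>

definition tree_orientation :: "('v \<Rightarrow> int) \<Rightarrow> 'v set set \<Rightarrow> ('v \<times> 'v) set \<Rightarrow> bool" where
  "tree_orientation d F A \<longleftrightarrow>
     (\<exists>nm. (\<forall>e\<in>F. {fst (nm e), snd (nm e)} = e) \<and>
           A = (\<lambda>e. if side_demand d F (nm e) \<ge> 0 then nm e else prod.swap (nm e)) ` F)"

definition aux_network ::
  "('v, 'e) interdiction_network \<Rightarrow> 'v set set \<Rightarrow> ('v \<times> 'v) set \<Rightarrow> ('v, 'e + 'v \<times> 'v) network" where
  "aux_network N F A =
     \<lparr>dgraph = \<lparr>verts = verts (dgraph N),
                arcs = Inl ` arcs (dgraph N) \<union> Inr ` A,
                tail = case_sum (tail (dgraph N)) fst,
                head = case_sum (head (dgraph N)) snd\<rparr>,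
      lcap = case_sum (lcap N) (side_demand (demand N) F),
      ucap = case_sum (ucap N) (side_demand (demand N) F),
      icost = case_sum (\<lambda>v. icost N (Inl v)) (case_sum (\<lambda>e. icost N (Inr e)) (\<lambda>_. \<infinity>))\<rparr>"

text \<open>
  Only original arcs are removed: the arcs \<open>Inr a\<close> of the tree and all vertices are kept.
\<close>

definition aux_interdict ::
  "('v, 'e + 'v \<times> 'v) network \<Rightarrow> ('v + 'e) set \<Rightarrow> ('v, 'e + 'v \<times> 'v) network" where
  "aux_interdict M R = M\<lparr>dgraph := (dgraph M)\<lparr>arcs := arcs (dgraph M) -
     {Inl e | e. Inr e \<in> R \<or> Inl (tail (dgraph M) (Inl e)) \<in> R \<or> Inl (head (dgraph M) (Inl e)) \<in> R}\<rparr>\<rparr>"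

end

theory Submission
  imports Defs
begin

text \<open>
  Send \<open>d(side of v)\<close> units along each tree arc \<open>(v, w)\<close>. As the total demand vanishes, the two sides
  of a tree edge have opposite demands, so the orientation of the edge is irrelevant. The sides
  \<open>tree_side F w v\<close> of the neighbours \<open>w\<close> of \<open>v\<close> partition \<open>W - {v}\<close>, so the net outflow of the tree
  flow at \<open>v\<close> is \<open>d(v)\<close>. The capacities force this flow on the tree arcs of every circulation, hence
  what remains on the original arcs is exactly a flow with net outflow \<open>-d(v)\<close> at every vertex \<open>v\<close>.
  Removed vertices have no surviving arcs, and their demand is 0 because terminals have infinite
  cost.
\<close>

section \<open>Sides of tree edges\<close>

text \<open>Repetitions are removed as the walk grows: if the new end already occurs, the list is
  cut right after that occurrence; otherwise the end is appended. Distinctness is what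
  \<open>ucycle\<close> asks for.\<close>

lemma rtrancl_imp_distinct_walk:
  assumes "(v, w) \<in> r\<^sup>*"
  shows "\<exists>vs. vs \<noteq> [] \<and> hd vs = v \<and> last vs = w \<and> distinct vs \<and>
    (\<forall>i. Suc i < length vs \<longrightarrow> (vs ! i, vs ! Suc i) \<in> r)"
  using assms
proof (induction rule: rtrancl_induct)
  case base
  show ?case by (rule exI[of _ "[v]"]) auto
next
  case (step y z)
  then obtain vs where vs: "vs \<noteq> []" "hd vs = v" "last vs = y" "distinct vs"
    "\<And>i. Suc i < length vs \<Longrightarrow> (vs ! i, vs ! Suc i) \<in> r" by blast
  show ?case
  proof (cases "z \<in> set vs")
    case True
    then obtain k where k: "k < length vs" "vs ! k = z" by (auto simp: in_set_conv_nth)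
    have "last (take (Suc k) vs) = z"
      using k by (simp add: take_Suc_conv_app_nth)
    then show ?thesis using vs k by (intro exI[of _ "take (Suc k) vs"]) auto
  next
    case False
    have "((vs @ [z]) ! i, (vs @ [z]) ! Suc i) \<in> r" if "Suc i < length (vs @ [z])" for i
    proof (cases "Suc i < length vs")
      case True
      then show ?thesis using vs(5) by (simp add: nth_append)
    next
      case False
      then have i: "Suc i = length vs" using that by simp
      then have "vs ! i = y" using vs(1,3) by (metis diff_Suc_1 last_conv_nth)
      then show ?thesis using i step.hyps(2) by (simp add: nth_append)
    qed
    then show ?thesis using vs False by (intro exI[of _ "vs @ [z]"]) auto
  qed
qed

lemma sym_adj: "sym (adj F)"
  by (auto simp: adj_def sym_def insert_commute)

lemma adj_rtrancl_sym: "(x, y) \<in> (adj F)\<^sup>* \<Longrightarrow> (y, x) \<in> (adj F)\<^sup>*"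
  using sym_rtrancl[OF sym_adj] by (meson symD)

lemma utree_edgeD:
  assumes "utree W F" "{v, w} \<in> F"
  shows "v \<in> W" "w \<in> W" "v \<noteq> w"
proof -
  have "{v, w} \<in> {{v, w} | v w. v \<in> W \<and> w \<in> W \<and> v \<noteq> w}"
    using assms by (auto simp: utree_def)
  then show "v \<in> W" "w \<in> W" "v \<noteq> w" by (auto simp: doubleton_eq_iff)
qed

text \<open>A repetition-free walk from \<open>v\<close> to \<open>w\<close> that avoids the edge
  would close up with the edge to a cycle.\<close>

lemma utree_bridge:
  assumes t: "utree W F" and e: "{v, w} \<in> F"
  shows "(v, w) \<notin> (adj (F - {{v, w}}))\<^sup>*"
proof
  assume "(v, w) \<in> (adj (F - {{v, w}}))\<^sup>*"
  from rtrancl_imp_distinct_walk[OF this] obtain vs where vs: "vs \<noteq> []" "hd vs = v" "last vs = w"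
    "distinct vs" "\<And>i. Suc i < length vs \<Longrightarrow> (vs ! i, vs ! Suc i) \<in> adj (F - {{v, w}})" by blast
  have first: "vs ! 0 = v" and final: "vs ! (length vs - 1) = w"
    using vs by (auto simp: hd_conv_nth last_conv_nth)
  \<comment> \<open>One vertex would mean \<open>v = w\<close>, and two vertices would mean that the
    walk uses the deleted edge.\<close>
  have "length vs \<noteq> 1" using first final utree_edgeD[OF t e] by auto
  moreover have "length vs \<noteq> 2"
    using vs(5)[of 0] first final by (auto simp: adj_def)
  moreover have "length vs \<noteq> 0" using vs(1) by simp
  ultimately have len: "length vs \<ge> 3" by linarith
  have "{vs ! i, vs ! (Suc i mod length vs)} \<in> F" if "i < length vs" for i
  proof (cases "Suc i < length vs")
    case True
    then show ?thesis using vs(5)[of i] by (simp add: adj_def)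
  next
    case False
    \<comment> \<open>At the last index the successor wraps around to 0, and the edge there is
      \<open>{w, v}\<close> itself.\<close>
    then have "Suc i = length vs" using that by simp
    then have "i = length vs - 1" "Suc i mod length vs = 0" by simp_all
    then show ?thesis using first final e by (simp add: insert_commute)
  qed
  then have "ucycle F vs" using len vs(4) by (simp add: ucycle_def)
  then show False using t by (auto simp: utree_def)
qed

section \<open>The two sides of a tree edge\<close>

lemma tree_side_refl: "v \<in> tree_side F v w"
  by (simp add: tree_side_def)

lemma tree_side_step:
  "x \<in> tree_side F v w \<Longrightarrow> {x, y} \<in> F \<Longrightarrow> {x, y} \<noteq> {v, w} \<Longrightarrow> y \<in> tree_side F v w"
  unfolding tree_side_def by (auto simp: adj_def intro: rtrancl_into_rtrancl)

lemma tree_side_subset: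
  assumes t: "utree W F" and v: "v \<in> W"
  shows "tree_side F v w \<subseteq> W"
proof
  fix x assume "x \<in> tree_side F v w"
  then have "(v, x) \<in> (adj (F - {{v, w}}))\<^sup>*" by (simp add: tree_side_def)
  then show "x \<in> W"
    by (induction rule: rtrancl_induct) (auto simp: adj_def v dest: utree_edgeD[OF t])
qed

text \<open>By symmetry of \<open>adj\<close>, a common vertex would connect \<open>v\<close> to
  \<open>w\<close> without their edge, which is a bridge.\<close>

lemma tree_sides_disjoint:
  assumes "utree W F" "{v, w} \<in> F"
  shows "tree_side F v w \<inter> tree_side F w v = {}"
proof -
  have False if "(v, x) \<in> (adj (F - {{v, w}}))\<^sup>*" "(w, x) \<in> (adj (F - {{v, w}}))\<^sup>*" for x
    using utree_bridge[OF assms] that adj_rtrancl_sym rtrancl_trans by metis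
  then show ?thesis by (auto simp: tree_side_def insert_commute)
qed

text \<open>Along a walk from \<open>v\<close>, a side can be left only through the edge
  \<open>{v, w}\<close>, and each end of that edge lies in its own side.\<close>

lemma tree_sides_Un:
  assumes t: "utree W F" and e: "{v, w} \<in> F"
  shows "tree_side F v w \<union> tree_side F w v = W"
proof
  show "tree_side F v w \<union> tree_side F w v \<subseteq> W"
    using tree_side_subset[OF t] utree_edgeD[OF t e] by blast
  show "W \<subseteq> tree_side F v w \<union> tree_side F w v"
  proof
    fix x assume "x \<in> W"
    then have "(v, x) \<in> (adj F)\<^sup>*" using t utree_edgeD[OF t e] by (auto simp: utree_def)
    then show "x \<in> tree_side F v w \<union> tree_side F w v"
    proof (induction rule: rtrancl_induct)
      case base
      show ?case by (simp add: tree_side_refl)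
    next
      case (step y z)
      have yz: "{y, z} \<in> F" using step.hyps by (simp add: adj_def)
      show ?case
      proof (cases "{y, z} = {v, w}")
        case True
        then have "z = v \<or> z = w" by blast
        then show ?thesis by (auto simp: tree_side_refl)
      next
        case False
        then have "{y, z} \<noteq> {w, v}" by (simp add: insert_commute)
        then show ?thesis using step.IH yz False tree_side_step by fast
      qed
    qed
  qed
qed

lemma notin_tree_side:
  assumes "utree W F" "{v, w} \<in> F"
  shows "v \<notin> tree_side F w v"
  using tree_sides_disjoint[OF assms] tree_side_refl by fast

section \<open>The sides at the neighbours of a vertex\<close>

text \<open>If the sides met, \<open>w2\<close> would be reachable from \<open>w1\<close> without
  passing \<open>v\<close>; one more step along \<open>{w2, v}\<close> would put \<open>v\<close>
  into the side of \<open>w1\<close>, contradicting \<open>notin_tree_side\<close>.\<close>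

lemma neighbour_sides_disjoint:
  assumes t: "utree W F" and e1: "{v, w1} \<in> F" and e2: "{v, w2} \<in> F" and ne: "w1 \<noteq> w2"
  shows "tree_side F w1 v \<inter> tree_side F w2 v = {}"
proof -
  \<comment> \<open>Each side is defined by deleting a different edge. Deleting all edges at
    \<open>v\<close> gives a common edge set in which walks from both sides can be joined.\<close>
  define F' where "F' = {e \<in> F. v \<notin> e}"
  have avoid: "(w, x) \<in> (adj F')\<^sup>*" if e: "{v, w} \<in> F" and x: "x \<in> tree_side F w v" for w x
  proof -
    have "(w, x) \<in> (adj (F - {{w, v}}))\<^sup>*" using x by (simp add: tree_side_def)
    then show ?thesis
    proof (induction rule: rtrancl_induct)
      case (step y z)
      \<comment> \<open>The walk stays inside the side, which misses \<open>v\<close>, so none of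
        its edges is incident to \<open>v\<close>.\<close>
      have "y \<in> tree_side F w v" "z \<in> tree_side F w v"
        using step.hyps by (auto simp: tree_side_def intro: rtrancl_into_rtrancl)
      then have "(y, z) \<in> adj F'"
        using step.hyps notin_tree_side[OF t e] by (auto simp: adj_def F'_def)
      then show ?case using step.IH by (rule rtrancl_into_rtrancl[rotated])
    qed simp
  qed
  have False if x: "x \<in> tree_side F w1 v" "x \<in> tree_side F w2 v" for x
  proof -
    have "(w1, w2) \<in> (adj F')\<^sup>*"
      using avoid[OF e1 x(1)] avoid[OF e2 x(2)] adj_rtrancl_sym rtrancl_trans by metis
    moreover have "adj F' \<subseteq> adj (F - {{w1, v}})" by (auto simp: adj_def F'_def)
    ultimately have "w2 \<in> tree_side F w1 v"
      using rtrancl_mono by (auto simp: tree_side_def)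
    then have "v \<in> tree_side F w1 v"
      using tree_side_step[of w2 F w1 v v] e2 ne utree_edgeD[OF t e2]
      by (auto simp: insert_commute doubleton_eq_iff)
    then show False using notin_tree_side[OF t e1] by simp
  qed
  then show ?thesis by blast
qed

text \<open>Along a walk from \<open>v\<close>, each step out of \<open>v\<close> enters the side of
  a neighbour, and each step between vertices other than \<open>v\<close> stays in its side.\<close>

lemma neighbour_sides_Un:
  assumes t: "utree W F" and v: "v \<in> W"
  shows "(\<Union>w\<in>{w. {v, w} \<in> F}. tree_side F w v) = W - {v}"
proof
  show "(\<Union>w\<in>{w. {v, w} \<in> F}. tree_side F w v) \<subseteq> W - {v}"
    using notin_tree_side[OF t] tree_side_subset[OF t] utree_edgeD[OF t] by blast
  show "W - {v} \<subseteq> (\<Union>w\<in>{w. {v, w} \<in> F}. tree_side F w v)"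
  proof
    fix x assume x: "x \<in> W - {v}"
    then have "(v, x) \<in> (adj F)\<^sup>*" using t v by (auto simp: utree_def)
    \<comment> \<open>The first disjunct lets the induction pass through returns of the walk to
      \<open>v\<close>.\<close>
    then have "x = v \<or> x \<in> (\<Union>w\<in>{w. {v, w} \<in> F}. tree_side F w v)"
    proof (induction rule: rtrancl_induct)
      case (step y z)
      have yz: "{y, z} \<in> F" using step.hyps by (simp add: adj_def)
      consider "z = v" | "y = v" | "y \<noteq> v" "z \<noteq> v" by blast
      then show ?case
      proof cases
        case 2
        then show ?thesis using yz tree_side_refl by fast
      next
        case 3
        then obtain w where w: "{v, w} \<in> F" "y \<in> tree_side F w v" using step.IH by blast
        have "{y, z} \<noteq> {w, v}" using 3 by (simp add: doubleton_eq_iff)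
        then show ?thesis using tree_side_step[OF w(2) yz] w(1) by blast
      qed simp
    qed simp
    then show "x \<in> (\<Union>w\<in>{w. {v, w} \<in> F}. tree_side F w v)" using x by blast
  qed
qed

section \<open>Demands of the sides\<close>

text \<open>The two sides partition \<open>W\<close>, whose total demand is 0.\<close>

lemma side_demand_swap:
  assumes "finite W" "utree W F" "sum d W = 0" "{v, w} \<in> F"
  shows "side_demand d F (w, v) = - side_demand d F (v, w)"
proof -
  have un: "tree_side F v w \<union> tree_side F w v = W" using tree_sides_Un assms by metis
  have "sum d (tree_side F v w) + sum d (tree_side F w v) = sum d W"
    using sum.union_disjoint[of "tree_side F v w" "tree_side F w v" d]
      tree_sides_disjoint[OF assms(2,4)] un assms(1) finite_Un by metis
  then show ?thesis using assms(3) by (simp add: side_demand_def)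
qed

text \<open>The sides of the neighbours partition \<open>W - {v}\<close>, which has demand
  \<open>- d v\<close>; passing to the opposite sides flips the sign of every term.\<close>

lemma sum_side_demand_neighbours:
  assumes fin: "finite W" and t: "utree W F" and zero: "sum d W = 0" and v: "v \<in> W"
  shows "(\<Sum>w | {v, w} \<in> F. side_demand d F (v, w)) = d v"
proof -
  let ?n = "{w. {v, w} \<in> F}"
  have n: "?n \<subseteq> W" using utree_edgeD[OF t] by blast
  have "(\<Sum>w\<in>?n. side_demand d F (w, v)) = sum d (\<Union>w\<in>?n. tree_side F w v)"
    unfolding side_demand_def prod.case
  proof (rule sum.UNION_disjoint[symmetric])
    show "finite ?n" using n fin finite_subset by blast
    show "\<forall>w\<in>?n. finite (tree_side F w v)"
      using n fin finite_subset tree_side_subset[OF t] by blast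
    show "\<forall>w1\<in>?n. \<forall>w2\<in>?n. w1 \<noteq> w2 \<longrightarrow> tree_side F w1 v \<inter> tree_side F w2 v = {}"
      using neighbour_sides_disjoint[OF t] by blast
  qed
  also have "\<dots> = - d v"
    using neighbour_sides_Un[OF t v] zero fin v by (simp add: sum_diff1)
  finally have "(\<Sum>w\<in>?n. side_demand d F (w, v)) = - d v" .
  moreover have "(\<Sum>w\<in>?n. side_demand d F (w, v)) = (\<Sum>w\<in>?n. - side_demand d F (v, w))"
    using side_demand_swap[OF fin t zero] by (intro sum.cong) auto
  ultimately show ?thesis by (simp add: sum_negf)
qed

section \<open>The flow on the oriented tree\<close>

text \<open>Packs the naming of the ends and the sign rule into one function \<open>g\<close> that
  picks an ordered pair for each edge.\<close>

lemma tree_orientation_choice: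
  assumes "tree_orientation d F A"
  obtains g where "A = g ` F" "\<And>e. e \<in> F \<Longrightarrow> {fst (g e), snd (g e)} = e"
proof -
  obtain nm where nm: "\<forall>e\<in>F. {fst (nm e), snd (nm e)} = e"
    and A: "A = (\<lambda>e. if side_demand d F (nm e) \<ge> 0 then nm e else prod.swap (nm e)) ` F"
    using assms unfolding tree_orientation_def by blast
  show thesis
    by (rule that[OF A]) (use nm in \<open>simp add: insert_commute\<close>)
qed

lemma tree_orientation_edge:
  assumes "tree_orientation d F A" "(v, w) \<in> A"
  shows "{v, w} \<in> F"
proof -
  obtain g where A: "A = g ` F" and g: "\<And>e. e \<in> F \<Longrightarrow> {fst (g e), snd (g e)} = e"
    using tree_orientation_choice[OF assms(1)] by blast
  obtain e where "e \<in> F" "g e = (v, w)" using assms(2) A by (metis imageE)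
  then show ?thesis using g[of e] by simp
qed

lemma tree_orientation_either:
  assumes "tree_orientation d F A" "{v, w} \<in> F"
  shows "(v, w) \<in> A \<or> (w, v) \<in> A"
proof -
  obtain g where A: "A = g ` F" and g: "\<And>e. e \<in> F \<Longrightarrow> {fst (g e), snd (g e)} = e"
    using tree_orientation_choice[OF assms(1)] by blast
  have "g {v, w} = (v, w) \<or> g {v, w} = (w, v)"
    using g[OF assms(2)] by (cases "g {v, w}") (simp add: doubleton_eq_iff)
  moreover have "g {v, w} \<in> A" using A assms(2) by blast
  ultimately show ?thesis by metis
qed

text \<open>Opposite arcs have the same pair of ends, hence come from one edge, to which
  \<open>g\<close> assigns only one ordered pair.\<close>

lemma tree_orientation_antisym:
  assumes "tree_orientation d F A" "(v, w) \<in> A" "(w, v) \<in> A"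
  shows "v = w"
proof -
  obtain g where A: "A = g ` F" and g: "\<And>e. e \<in> F \<Longrightarrow> {fst (g e), snd (g e)} = e"
    using tree_orientation_choice[OF assms(1)] by blast
  obtain e1 e2 where e: "e1 \<in> F" "g e1 = (v, w)" "e2 \<in> F" "g e2 = (w, v)"
    using assms(2,3) A by (metis imageE)
  have "e1 = {v, w}" "e2 = {w, v}" using g[OF e(1)] g[OF e(3)] e(2,4) by simp_all
  then have "e1 = e2" by (simp add: insert_commute)
  then show ?thesis using e(2,4) by (metis prod.inject)
qed

text \<open>An incoming arc \<open>(w, v)\<close> carries the negative of the demand for
  \<open>(v, w)\<close>. Subtracting the inflow therefore yields one sum over all neighbours of
  \<open>v\<close>, however their edges are oriented.\<close>

lemma tree_flow_net_outflow:
  assumes fin: "finite W" and t: "utree W F" and zero: "sum d W = 0"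
    and A: "tree_orientation d F A" and out: "v \<notin> W \<Longrightarrow> d v = 0"
  shows "(\<Sum>a | a \<in> A \<and> fst a = v. side_demand d F a) -
    (\<Sum>a | a \<in> A \<and> snd a = v. side_demand d F a) = d v"
proof -
  let ?n = "{w. {v, w} \<in> F}" and ?out = "{w. (v, w) \<in> A}" and ?in = "{w. (w, v) \<in> A}"
  have n: "?n \<subseteq> W" using utree_edgeD[OF t] by blast
  then have finn: "finite ?n" using fin finite_subset by blast
  have un: "?out \<union> ?in = ?n"
    using tree_orientation_either[OF A] tree_orientation_edge[OF A] insert_commute[of v _ "{}"]
    by (intro set_eqI) (simp, metis)
  have disj: "?out \<inter> ?in = {}"
    using tree_orientation_antisym[OF A] tree_orientation_edge[OF A] utree_edgeD(3)[OF t] by blast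
  have fins: "finite ?out" "finite ?in" using un finn finite_Un by metis+
  have "(\<Sum>a | a \<in> A \<and> fst a = v. side_demand d F a) = (\<Sum>w\<in>?out. side_demand d F (v, w))"
    by (rule sum.reindex_bij_witness[of _ "Pair v" snd]) auto
  moreover have "(\<Sum>a | a \<in> A \<and> snd a = v. side_demand d F a) = (\<Sum>w\<in>?in. side_demand d F (w, v))"
    by (rule sum.reindex_bij_witness[of _ "\<lambda>w. (w, v)" fst]) auto
  moreover have "(\<Sum>w\<in>?in. side_demand d F (w, v)) = (\<Sum>w\<in>?in. - side_demand d F (v, w))"
    using un side_demand_swap[OF fin t zero] by (intro sum.cong) auto
  ultimately have "(\<Sum>a | a \<in> A \<and> fst a = v. side_demand d F a) -
      (\<Sum>a | a \<in> A \<and> snd a = v. side_demand d F a) = (\<Sum>w\<in>?n. side_demand d F (v, w))"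
    using sum.union_disjoint[OF fins disj, of "\<lambda>w. side_demand d F (v, w)"] un
    by (simp add: sum_negf)
  also have "\<dots> = d v"
  proof (cases "v \<in> W")
    case True
    then show ?thesis using sum_side_demand_neighbours[OF fin t zero] by blast
  next
    case False
    then have "?n = {}" using utree_edgeD(1)[OF t] by blast
    then show ?thesis using out False by simp
  qed
  finally show ?thesis .
qed

section \<open>Saturating flows and circulations\<close>

lemma dgraph_interdict:
  "dgraph (interdict N R) =
    (dgraph N)\<lparr>verts := {v \<in> verts (dgraph N). Inl v \<notin> R}, arcs := surviving_arcs (dgraph N) R\<rparr>"
  by (simp add: interdict_def)

lemma arcs_aux_interdict:
  "arcs (dgraph (aux_interdict (aux_network N F A) R)) =
    Inl ` surviving_arcs (dgraph N) R \<union> Inr ` A"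
  by (auto simp: aux_interdict_def aux_network_def surviving_arcs_def)

lemma net_outflow_aux_interdict:
  assumes "finite (arcs (dgraph N))" "finite A"
  shows "net_outflow (dgraph (aux_interdict (aux_network N F A) R)) g v =
    net_outflow (dgraph (interdict N R)) (g \<circ> Inl) v +
    ((\<Sum>a | a \<in> A \<and> fst a = v. g (Inr a)) - (\<Sum>a | a \<in> A \<and> snd a = v. g (Inr a)))"
proof -
  let ?H = "dgraph (aux_interdict (aux_network N F A) R)" and ?G = "dgraph (interdict N R)"
  have ends: "tail ?H = case_sum (tail (dgraph N)) fst" "head ?H = case_sum (head (dgraph N)) snd"
    by (simp_all add: aux_interdict_def aux_network_def)
  have out: "out_arcs ?H v = Inl ` out_arcs ?G v \<union> Inr ` {a. a \<in> A \<and> fst a = v}"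
    and inn: "in_arcs ?H v = Inl ` in_arcs ?G v \<union> Inr ` {a. a \<in> A \<and> snd a = v}"
    unfolding out_arcs_def in_arcs_def arcs_aux_interdict ends by (auto simp: dgraph_interdict)
  have fin: "finite (out_arcs ?G v)" "finite (in_arcs ?G v)"
    using assms(1) by (auto simp: out_arcs_def in_arcs_def dgraph_interdict surviving_arcs_def)
  have split: "sum g (Inl ` X \<union> Inr ` Y) = sum (g \<circ> Inl) X + (\<Sum>a\<in>Y. g (Inr a))"
    if "finite X" "finite Y" for X Y
    using that by (subst sum.union_disjoint) (auto simp: sum.reindex o_def)
  show ?thesis
    unfolding net_outflow_def out inn using fin assms(2) by (simp add: split)
qed

text \<open>Costs are nonnegative, so a single infinite cost in \<open>R\<close> would exceed the
  finite budget.\<close>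

lemma terminal_notin_interdiction_set:
  assumes "planar_interdiction_network N" "interdiction_set N B R" "v \<in> sources N \<union> sinks N"
  shows "Inl v \<notin> R"
proof
  assume v: "Inl v \<in> R"
  interpret planar_interdiction_network N by fact
  interpret G: fin_digraph "dgraph N" by (rule fin_digraph)
  \<comment> \<open>A sum over an infinite set defaults to 0, so finiteness is required before
    comparing one cost with the total.\<close>
  have "finite R"
    using assms(2) G.finite_verts G.finite_arcs unfolding interdiction_set_def
    by (meson finite_UnI finite_imageI finite_subset)
  then have "icost N (Inl v) \<le> (\<Sum>p\<in>R. icost N p)" using v by (simp add: member_le_sum)
  also have "\<dots> \<le> enat B" using assms(2) by (simp add: interdiction_set_def)
  finally show False using icost_terminal[OF assms(3)] by simp
qed

text \<open>Brings sources, sinks and other vertices into one balance condition over all original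
  vertices, which is the vertex set of the auxiliary network. At deleted vertices it reads
  \<open>0 = 0\<close>.\<close>

lemma saturating_flow_interdict_iff:
  assumes net: "planar_interdiction_network N" and R: "interdiction_set N B R"
  shows "saturating_flow (interdict N R) f \<longleftrightarrow> within_capacities (interdict N R) f \<and>
    (\<forall>v\<in>verts (dgraph N). net_outflow (dgraph (interdict N R)) f v = - of_int (demand N v))"
proof -
  interpret planar_interdiction_network N by fact
  let ?G = "dgraph (interdict N R)"
  let ?S = "sources N" and ?T = "sinks N" and ?V = "verts (dgraph N)"
  have inflow: "net_inflow ?G f v = of_int (demand N v) \<longleftrightarrow>
      net_outflow ?G f v = - of_int (demand N v)" for v
    by (auto simp: net_inflow_def net_outflow_def)
  have other: "demand N v = 0" if "v \<in> ?V - (?S \<union> ?T)" for v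
    using demand_other that by blast
  have removed: "net_outflow ?G f v = - of_int (demand N v)" if v: "v \<in> ?V" "Inl v \<in> R" for v
  proof -
    have "out_arcs ?G v = {}" "in_arcs ?G v = {}"
      using v(2) by (auto simp: out_arcs_def in_arcs_def dgraph_interdict surviving_arcs_def)
    moreover have "demand N v = 0"
      using other terminal_notin_interdiction_set[OF net R] v by blast
    ultimately show ?thesis by (simp add: net_outflow_def)
  qed
  have "saturating_flow (interdict N R) f \<longleftrightarrow> within_capacities (interdict N R) f \<and>
    (\<forall>v\<in>?S. net_outflow ?G f v = - of_int (demand N v)) \<and>
    (\<forall>v\<in>?T. net_outflow ?G f v = - of_int (demand N v)) \<and>
    (\<forall>v\<in>{v \<in> ?V. Inl v \<notin> R} - (?S \<union> ?T). net_outflow ?G f v = 0)"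
    using inflow by (simp add: saturating_flow_def interdict_def)
  also have "(\<forall>v\<in>{v \<in> ?V. Inl v \<notin> R} - (?S \<union> ?T). net_outflow ?G f v = 0) \<longleftrightarrow>
    (\<forall>v\<in>?V - (?S \<union> ?T). net_outflow ?G f v = - of_int (demand N v))"
    using other removed by auto
  finally show ?thesis using sources_verts sinks_verts by blast
qed

text \<open>Lower and upper capacity coincide on tree arcs, which fixes the flow there.\<close>

lemma within_capacities_aux_interdict:
  "within_capacities (aux_interdict (aux_network N F A) R) g \<longleftrightarrow>
    within_capacities (interdict N R) (g \<circ> Inl) \<and>
    (\<forall>a\<in>A. g (Inr a) = of_int (side_demand (demand N) F a))"
  unfolding within_capacities_def arcs_aux_interdict
  by (auto simp: aux_interdict_def aux_network_def interdict_def ball_Un)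

text \<open>With the tree values fixed, the tree arcs add exactly \<open>demand N v\<close> to the
  net outflow at \<open>v\<close>. Conservation thus means net outflow \<open>- demand N v\<close>
  on the surviving original arcs.\<close>

lemma circulation_aux_interdict_iff:
  assumes net: "planar_interdiction_network N"
    and bal: "- (\<Sum>s\<in>sources N. demand N s) = (\<Sum>t\<in>sinks N. demand N t)"
    and tree: "terminal_tree N W F" and A: "tree_orientation (demand N) F A"
    and R: "interdiction_set N B R"
  shows "circulation (aux_interdict (aux_network N F A) R) g \<longleftrightarrow>
    saturating_flow (interdict N R) (g \<circ> Inl) \<and>
    (\<forall>a\<in>A. g (Inr a) = of_int (side_demand (demand N) F a))"
proof -
  interpret planar_interdiction_network N by fact
  interpret G: fin_digraph "dgraph N" by (rule fin_digraph)
  let ?S = "sources N" and ?T = "sinks N" and ?V = "verts (dgraph N)"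
  let ?H = "dgraph (aux_interdict (aux_network N F A) R)" and ?G = "dgraph (interdict N R)"
  have t: "utree W F" and W: "W \<subseteq> ?V" "?S \<union> ?T \<subseteq> W"
    using tree by (auto simp: terminal_tree_def)
  have finW: "finite W" using W(1) G.finite_verts finite_subset by blast
  have "A \<subseteq> W \<times> W" using tree_orientation_edge[OF A] utree_edgeD(1,2)[OF t] by fast
  then have finA: "finite A" using finW finite_subset by blast
  have finST: "finite ?S" "finite ?T" using W finW finite_subset by blast+
  \<comment> \<open>\<open>W\<close> contains all terminals and its other vertices have demand 0, so
    the balance of supply and demand becomes \<open>sum (demand N) W = 0\<close>.\<close>
  have "sum (demand N) W = sum (demand N) (?S \<union> ?T)"
    using W finW demand_other by (intro sum.mono_neutral_right) auto
  also have "\<dots> = 0"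
    using bal by (simp add: sum.union_disjoint[OF finST sources_sinks_disjoint])
  finally have zero: "sum (demand N) W = 0" .
  have verts: "verts ?H = ?V" by (simp add: aux_interdict_def aux_network_def)
  have "net_outflow ?H g v = net_outflow ?G (g \<circ> Inl) v + of_int (demand N v)"
    if v: "v \<in> ?V" and g: "\<forall>a\<in>A. g (Inr a) = of_int (side_demand (demand N) F a)" for v
  proof -
    have out: "demand N v = 0" if "v \<notin> W" using that W demand_other v by blast
    have "(\<Sum>a | a \<in> A \<and> fst a = v. g (Inr a)) - (\<Sum>a | a \<in> A \<and> snd a = v. g (Inr a)) =
      of_int ((\<Sum>a | a \<in> A \<and> fst a = v. side_demand (demand N) F a) -
        (\<Sum>a | a \<in> A \<and> snd a = v. side_demand (demand N) F a))"
      using g by simp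
    also have "\<dots> = of_int (demand N v)"
      by (intro arg_cong[where f = of_int] tree_flow_net_outflow[OF finW t zero A] out)
    finally show ?thesis
      using net_outflow_aux_interdict[OF G.finite_arcs finA] by simp
  qed
  then show ?thesis
    unfolding circulation_def within_capacities_aux_interdict verts
      saturating_flow_interdict_iff[OF net R]
    by (auto simp: add_eq_0_iff2)
qed

theorem theorem7:
  fixes N :: "('v, 'e) interdiction_network"
    and W :: "'v set" and F :: "'v set set" and A :: "('v \<times> 'v) set"
    and B :: nat and R :: "('v + 'e) set"
  assumes "planar_interdiction_network N"
    and "- (\<Sum>s\<in>sources N. demand N s) = (\<Sum>t\<in>sinks N. demand N t)"
    and "terminal_tree N W F"
    and "tree_orientation (demand N) F A"
    and "interdiction_set N B R"
  shows "(\<exists>f. saturating_flow (interdict N R) f) \<longleftrightarrow>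
         (\<exists>f. circulation (aux_interdict (aux_network N F A) R) f)"
proof
  assume "\<exists>f. saturating_flow (interdict N R) f"
  then obtain f where "saturating_flow (interdict N R) f" ..
  \<comment> \<open>The flow is extended to the tree arcs by the values that the capacities
    force.\<close>
  then have "circulation (aux_interdict (aux_network N F A) R)
      (case_sum f (\<lambda>a. of_int (side_demand (demand N) F a)))"
    by (simp add: circulation_aux_interdict_iff[OF assms] o_def)
  then show "\<exists>f. circulation (aux_interdict (aux_network N F A) R) f" by blast
next
  assume "\<exists>f. circulation (aux_interdict (aux_network N F A) R) f"
  then show "\<exists>f. saturating_flow (interdict N R) f"
    using circulation_aux_interdict_iff[OF assms] by blast
qed

end
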